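(* Let $N$ and $M$ be von Neumann algebras with faithful normal states $\rho$ and $\varphi$ respectively, and let $\Phi:N\to M$ be a $(\rho,\varphi)$-Markov map. Denote by $N_\rho\subseteq N$ and $M_\varphi\subseteq M$ the respective subalgebras of entire analytic elements. Then $\Phi(N_\rho)\subseteq M_\varphi$, and for any $x\in N_\rho$ and $z\in\mathbb{C}$, $$\Phi\circ\sigma_z^\rho(x)=\sigma_z^\varphi\circ\Phi(x).$$
   Context: Von Neumann algebras are assumed to have separable preduals. $(\sigma_t^\rho)_{t\in\mathbb{R}}$ denotes the modular automorphism group of $\rho$. A $(\rho,\varphi)$-Markov map $\Phi:N\to M$ is a linear, unital, completely positive map with $\varphi\circ\Phi=\rho$ and $\sigma_t^\varphi\circ\Phi=\Phi\circ\sigma_t^\rho$ for all $t\in\mathbb{R}$. $N_\rho$ is the set of $x\in N$ for which there is a weak-$*$ entire function $F_x:\mathbb{C}\to N$ with $F_x(it)=\sigma_t^\rho(x)$ for all $t\in\mathbb{R}$ (such $F_x$ is unique; $N_\rho$ is a weak-$*$ dense $*$-subalgebra of $N$). For $x\in N_\rho$ and $z\in\mathbb{C}$ one sets $\sigma_{-iz}^\rho(x)=F_x(z)$. $M_\varphi$ and $\sigma_z^\varphi$ are defined analogously. *)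

theory Defs
  imports "HOL-Analysis.Analysis" "HOL-Library.Nonpos_Ints"
begin

section \<open>Complex Hilbert spaces\<close>

class scaleC =
  fixes scaleC :: "complex \<Rightarrow> 'a \<Rightarrow> 'a"  (infixr "*\<^sub>C" 75)

class complex_vector = real_vector + scaleC +
  assumes scaleC_add_right: "c *\<^sub>C (x + y) = c *\<^sub>C x + c *\<^sub>C y"
    and scaleC_add_left: "(c + d) *\<^sub>C x = c *\<^sub>C x + d *\<^sub>C x"
    and scaleC_scaleC: "c *\<^sub>C d *\<^sub>C x = (c * d) *\<^sub>C x"
    and scaleR_scaleC: "r *\<^sub>R x = complex_of_real r *\<^sub>C x"

text \<open>The inner product is linear in the first argument.\<close>

class complex_inner = complex_vector + real_normed_vector +
  fixes cinner :: "'a \<Rightarrow> 'a \<Rightarrow> complex"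
  assumes cinner_commute: "cinner x y = cnj (cinner y x)"
    and cinner_add_left: "cinner (x + y) z = cinner x z + cinner y z"
    and cinner_scaleC_left: "cinner (c *\<^sub>C x) y = c * cinner x y"
    and cinner_self: "cinner x x = complex_of_real ((norm x)\<^sup>2)"

class chilbert_space = complex_inner + complete_space

instantiation complex :: chilbert_space
begin

definition scaleC_complex :: "complex \<Rightarrow> complex \<Rightarrow> complex"
  where "scaleC_complex c x = c * x"

definition cinner_complex :: "complex \<Rightarrow> complex \<Rightarrow> complex"
  where "cinner_complex x y = x * cnj y"

instance
proof
  fix x :: complex
  show "cinner x x = complex_of_real ((norm x)\<^sup>2)"
    by (simp add: cinner_complex_def complex_norm_square del: of_real_power)
qed (auto simp: scaleC_complex_def cinner_complex_def algebra_simps scaleR_conv_of_real)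

end

context complex_inner
begin

lemma cinner_add_right: "cinner x (y + z) = cinner x y + cinner x z"
  by (metis cinner_add_left cinner_commute complex_cnj_add)

lemma cinner_scaleC_right: "cinner x (c *\<^sub>C y) = cnj c * cinner x y"
  by (metis cinner_commute cinner_scaleC_left complex_cnj_mult)

end

lemma norm_scaleC: "norm (c *\<^sub>C x) = cmod c * norm (x :: 'a :: complex_inner)"
proof -
  have "complex_of_real ((norm (c *\<^sub>C x))\<^sup>2) = (c * cnj c) * cinner x x"
    by (simp only: cinner_self[symmetric] cinner_scaleC_left cinner_scaleC_right) simp
  also have "\<dots> = complex_of_real ((cmod c * norm x)\<^sup>2)"
    by (simp only: cinner_self complex_norm_square[symmetric] power_mult_distrib of_real_mult)
  finally have "(norm (c *\<^sub>C x))\<^sup>2 = (cmod c * norm x)\<^sup>2"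
    using of_real_eq_iff by blast
  then show ?thesis by simp
qed

lemma bounded_linear_scaleC: "bounded_linear (\<lambda>x :: 'a :: complex_inner. c *\<^sub>C x)"
  by (rule bounded_linear_intro[where K = "cmod c"])
     (simp_all add: scaleC_add_right scaleR_scaleC scaleC_scaleC norm_scaleC mult.commute)


section \<open>Bounded operators\<close>

text \<open>The type \<open>'h \<Rightarrow>\<^sub>L 'h\<close> consists of the real-linear bounded maps; the bounded operators of
  the Hilbert space are those that are also complex-linear.\<close>

type_synonym 'h operator = "'h \<Rightarrow>\<^sub>L 'h"

instantiation blinfun :: (real_normed_vector, complex_inner) complex_vector
begin

lift_definition scaleC_blinfun :: "complex \<Rightarrow> 'a \<Rightarrow>\<^sub>L 'b \<Rightarrow> 'a \<Rightarrow>\<^sub>L 'b"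
  is "\<lambda>c f x. c *\<^sub>C f x"
  by (rule bounded_linear_compose[OF bounded_linear_scaleC])

instance
  by standard (transfer; simp add: fun_eq_iff scaleC_add_right scaleC_add_left scaleC_scaleC
    scaleR_scaleC)+

end

definition bounded_ops :: "('h :: chilbert_space) operator set"
  where "bounded_ops = {x. \<forall>c \<xi>. blinfun_apply x (c *\<^sub>C \<xi>) = c *\<^sub>C blinfun_apply x \<xi>}"

text \<open>The description is well-defined by \<open>adj_unique\<close> and \<open>adj_exists\<close> below.\<close>

definition adj :: "('h :: chilbert_space) operator \<Rightarrow> 'h operator"
  where "adj x = (THE y. y \<in> bounded_ops \<and>
    (\<forall>\<xi> \<eta>. cinner (blinfun_apply x \<xi>) \<eta> = cinner \<xi> (blinfun_apply y \<eta>)))"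


lemma cinner_zero_left [simp]: "cinner 0 (y :: 'a :: complex_inner) = 0"
  using cinner_add_left[of 0 0 y] by simp

lemma cinner_minus_left: "cinner (- x) (y :: 'a :: complex_inner) = - cinner x y"
  using cinner_add_left[of x "- x" y] by (simp add: add_eq_0_iff2)

lemma cinner_diff_right: "cinner x (y - z) = cinner x y - cinner x (z :: 'a :: complex_inner)"
  using cinner_add_right[of x "y - z" z] by simp

lemma cinner_scaleR_left: "cinner (r *\<^sub>R x) (y :: 'a :: complex_inner) = of_real r * cinner x y"
  by (simp add: scaleR_scaleC cinner_scaleC_left)

lemma cinner_eq_0_all: "(\<And>x. cinner x y = 0) \<Longrightarrow> (y :: 'a :: complex_inner) = 0"
  using cinner_self[of y] by simp

lemma norm_add_sq:
  "(norm (x + y))\<^sup>2 = (norm x)\<^sup>2 + 2 * Re (cinner x y) + (norm (y :: 'a :: complex_inner))\<^sup>2"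
proof -
  have "(norm (x + y))\<^sup>2 = Re (cinner (x + y) (x + y))"
    by (simp add: cinner_self)
  also have "\<dots> = Re (cinner x x) + Re (cinner x y) + Re (cinner y x) + Re (cinner y y)"
    by (simp add: cinner_add_left cinner_add_right)
  also have "Re (cinner y x) = Re (cinner x y)"
    by (subst cinner_commute) simp
  finally show ?thesis by (simp add: cinner_self)
qed

lemma linear_le_quadratic_zero:
  fixes a b :: real
  assumes "\<And>t. 2 * t * a \<le> t\<^sup>2 * b"
  shows "a = 0"
proof (rule ccontr)
  assume "a \<noteq> 0"
  define c where "c = \<bar>b\<bar> + 1"
  have c: "c > 0" "b < c" by (auto simp: c_def)
  have "2 * (a / c) * a \<le> (a / c)\<^sup>2 * b" by (rule assms)
  also have "\<dots> \<le> (a / c)\<^sup>2 * c" using c by (intro mult_left_mono) auto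
  also have "\<dots> = (a / c) * a" using c by (simp add: power2_eq_square)
  finally have "a * a / c \<le> 0" by simp
  moreover have "a * a / c > 0" using \<open>a \<noteq> 0\<close> c by (simp add: zero_less_mult_iff linorder_neq_iff[symmetric])
  ultimately show False by simp
qed

lemma Re_cinner_le: "Re (cinner x y) \<le> norm x * norm (y :: 'a :: complex_inner)"
proof (cases "y = 0")
  case True
  have "cinner x y = 0" using cinner_commute[of x y] True by simp
  then show ?thesis using True by simp
next
  case False
  have "(norm (x + y))\<^sup>2 \<le> (norm x + norm y)\<^sup>2"
    by (intro power_mono norm_triangle_ineq) simp
  then show ?thesis by (simp add: norm_add_sq power2_sum)
qed

lemma cmod_cinner_le: "cmod (cinner x y) \<le> norm x * norm (y :: 'a :: complex_inner)"
proof (cases "cinner x y = 0")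
  case False
  define c where "c = cnj (cinner x y) / cmod (cinner x y)"
  have c: "cmod c = 1" using False by (simp add: c_def norm_divide)
  have "c * cinner x y = cmod (cinner x y)"
    using False complex_norm_square[of "cinner x y"]
    by (simp add: c_def power2_eq_square mult.commute nonzero_divide_eq_eq)
  then have "cmod (cinner x y) = Re (cinner (c *\<^sub>C x) y)"
    by (simp add: cinner_scaleC_left)
  also have "\<dots> \<le> norm (c *\<^sub>C x) * norm y" by (rule Re_cinner_le)
  finally show ?thesis by (simp add: norm_scaleC c)
qed simp

lemma riesz_representation:
  fixes f :: "'a :: chilbert_space \<Rightarrow> complex"
  assumes add: "\<And>x y. f (x + y) = f x + f y"
    and scale: "\<And>c x. f (c *\<^sub>C x) = c * f x"
    and bdd: "\<And>x. cmod (f x) \<le> B * norm x"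
  shows "\<exists>v. \<forall>x. f x = cinner x v"
proof -
  define J where "J v = (norm v)\<^sup>2 - 2 * Re (f v)" for v
  have fR: "f (r *\<^sub>R x) = of_real r * f x" for r x
    by (simp add: scaleR_scaleC scale)
  have fdiff: "f (x - y) = f x - f y" for x y
    using add[of "x - y" y] by simp
  have J_ge: "J v \<ge> - B\<^sup>2" for v
  proof -
    have "Re (f v) \<le> B * norm v" using bdd[of v] complex_Re_le_cmod[of "f v"] by linarith
    moreover have "0 \<le> (norm v - B)\<^sup>2" by simp
    ultimately show ?thesis unfolding J_def power2_diff by (simp add: mult.commute)
  qed
  define d where "d = (INF v. J v)"
  have bb: "bdd_below (range J)" using J_ge by (auto intro!: bdd_belowI)
  have d_le: "d \<le> J v" for v unfolding d_def using bb by (rule cINF_lower) simp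
  have "\<exists>v. J v < d + 1 / real (Suc n)" for n
  proof -
    have "(INF v. J v) < d + 1 / real (Suc n)" by (simp add: d_def)
    then show ?thesis using cINF_less_iff[OF _ bb] by auto
  qed
  then obtain v where v: "\<And>n. J (v n) < d + 1 / real (Suc n)" by metis
  have par: "(norm (x - y))\<^sup>2 = 2 * J x + 2 * J y - 4 * J ((1/2) *\<^sub>R (x + y))" for x y
  proof -
    have "cinner x (- y) = - cinner x y" 
      using cinner_diff_right[of x 0 y] cinner_diff_right[of x 0 0] by simp
    then have "(norm (x - y))\<^sup>2 = (norm x)\<^sup>2 - 2 * Re (cinner x y) + (norm y)\<^sup>2"
      using norm_add_sq[of x "- y"] by simp
    moreover have "(norm ((1/2) *\<^sub>R (x + y)))\<^sup>2 = (norm (x + y))\<^sup>2 / 4"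
      by (simp only: norm_scaleR power_mult_distrib) (simp add: power2_eq_square)
    moreover have "Re (f ((1/2) *\<^sub>R (x + y))) = (Re (f x) + Re (f y)) / 2"
      by (simp only: fR add) simp
    ultimately show ?thesis
      unfolding J_def norm_add_sq[of x y] by argo
  qed
  have dist_le: "(norm (v m - v n))\<^sup>2 \<le> 2 / real (Suc m) + 2 / real (Suc n)" for m n
    using par[of "v m" "v n"] v[of m] v[of n] d_le[of "(1/2) *\<^sub>R (v m + v n)"] by simp
  have "Cauchy v"
  proof (rule metric_CauchyI)
    fix e :: real assume e: "e > 0"
    obtain M where M: "4 / e\<^sup>2 < real M" using reals_Archimedean2 by blast
    have "dist (v m) (v n) < e" if "m \<ge> M" "n \<ge> M" for m n
    proof -
      have M0: "real M > 0" using M e by (smt (verit) divide_pos_pos zero_less_power)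
      have "2 / real (Suc m) \<le> 2 / real M" "2 / real (Suc n) \<le> 2 / real M"
        using that M0 by (auto intro!: divide_left_mono)
      then have "(norm (v m - v n))\<^sup>2 \<le> 4 / real M" using dist_le[of m n] by linarith
      also have "\<dots> < e\<^sup>2" using M M0 e by (simp add: field_simps)
      finally show ?thesis using e by (simp add: dist_norm power2_less_imp_less)
    qed
    then show "\<exists>M. \<forall>m\<ge>M. \<forall>n\<ge>M. dist (v m) (v n) < e" by blast
  qed
  then obtain w where w: "v \<longlonglongrightarrow> w" using Cauchy_convergent convergent_def by blast
  have blf: "bounded_linear f"
    by (rule bounded_linear_intro[where K = B])
       (use bdd in \<open>auto simp: add fR scaleR_conv_of_real mult.commute\<close>)
  have "(\<lambda>n. J (v n)) \<longlonglongrightarrow> J w"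
    unfolding J_def by (intro tendsto_intros bounded_linear.tendsto[OF blf] w)
  moreover have "(\<lambda>n. d + 1 / real (Suc n)) \<longlonglongrightarrow> d + 0"
    by (intro tendsto_add tendsto_const LIMSEQ_Suc[OF lim_1_over_n])
  ultimately have Jw: "J w \<le> d"
    using v by (intro LIMSEQ_le[of _ "J w" _ d]) (auto intro: less_imp_le)
  have Re_eq: "Re (f x) = Re (cinner x w)" for x
  proof -
    have "2 * t * (Re (f x) - Re (cinner x w)) \<le> t\<^sup>2 * (norm x)\<^sup>2" for t
    proof -
      have "J w \<le> J (t *\<^sub>R x + w)" using Jw d_le order_trans by blast
      then show ?thesis unfolding J_def add fR norm_add_sq cinner_scaleR_left
        by (simp add: algebra_simps power_mult_distrib)
    qed
    then show ?thesis using linear_le_quadratic_zero by force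
  qed
  have "f x = cinner x w" for x
  proof (rule complex_eqI)
    show "Re (f x) = Re (cinner x w)" by (rule Re_eq)
    show "Im (f x) = Im (cinner x w)"
      using Re_eq[of "\<i> *\<^sub>C x"] by (simp add: scale cinner_scaleC_left)
  qed
  then show ?thesis by blast
qed

lemma adj_unique:
  assumes "\<And>\<xi> \<eta>. cinner (blinfun_apply x \<xi>) \<eta> = cinner \<xi> (blinfun_apply y \<eta>)"
    and "\<And>\<xi> \<eta>. cinner (blinfun_apply x \<xi>) \<eta> = cinner \<xi> (blinfun_apply z \<eta>)"
  shows "y = (z :: 'h :: chilbert_space operator)"
proof (rule blinfun_eqI)
  fix \<eta>
  have "blinfun_apply y \<eta> - blinfun_apply z \<eta> = 0"
    by (rule cinner_eq_0_all) (use assms in \<open>simp add: cinner_diff_right\<close>)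
  then show "blinfun_apply y \<eta> = blinfun_apply z \<eta>" by simp
qed

lemma adj_exists:
  assumes x: "x \<in> bounded_ops"
  shows "\<exists>y \<in> bounded_ops. \<forall>\<xi> \<eta>. cinner (blinfun_apply x \<xi>) \<eta> = cinner \<xi> (blinfun_apply y \<eta>)"
proof -
  have "\<exists>v. \<forall>\<xi>. cinner (blinfun_apply x \<xi>) \<eta> = cinner \<xi> v" for \<eta>
  proof (rule riesz_representation[where B = "norm x * norm \<eta>"])
    show "cmod (cinner (blinfun_apply x \<xi>) \<eta>) \<le> norm x * norm \<eta> * norm \<xi>" for \<xi>
      using order_trans[OF cmod_cinner_le mult_right_mono[OF norm_blinfun[of x \<xi>] norm_ge_zero[of \<eta>]]]
      by (simp add: mult_ac)
  qed (use x in \<open>auto simp: bounded_ops_def blinfun.add_right cinner_add_left cinner_scaleC_left\<close>)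
  then obtain g where g: "\<And>\<xi> \<eta>. cinner (blinfun_apply x \<xi>) \<eta> = cinner \<xi> (g \<eta>)" by metis
  have eqI: "u = w" if "\<And>\<xi>. cinner \<xi> u = cinner \<xi> w" for u w :: 'a
    using cinner_eq_0_all[of "u - w"] that by (simp add: cinner_diff_right)
  have g_add: "g (a + b) = g a + g b" for a b
    by (rule eqI) (simp add: g[symmetric] cinner_add_right)
  have g_scale: "g (c *\<^sub>C a) = c *\<^sub>C g a" for c a
    by (rule eqI) (simp add: g[symmetric] cinner_scaleC_right)
  have g_norm: "norm (g a) \<le> norm a * norm x" for a
  proof (cases "g a = 0")
    case False
    have "(norm (g a))\<^sup>2 = cmod (cinner (g a) (g a))"
      unfolding cinner_self norm_of_real by simp
    also have "\<dots> = cmod (cinner (blinfun_apply x (g a)) a)" by (simp add: g)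
    also have "\<dots> \<le> norm x * norm (g a) * norm a"
      by (rule order_trans[OF cmod_cinner_le mult_right_mono[OF norm_blinfun]]) simp
    finally show ?thesis using False by (simp add: power2_eq_square mult_ac)
  qed simp
  have bl: "bounded_linear g"
    by (rule bounded_linear_intro[where K = "norm x"])
       (simp_all add: g_add g_scale scaleR_scaleC g_norm)
  show ?thesis
    by (rule bexI[of _ "Blinfun g"])
       (auto simp: bounded_linear_Blinfun_apply[OF bl] g bounded_ops_def g_scale)
qed

lemma
  assumes "x \<in> bounded_ops"
  shows adj_bounded_ops: "adj x \<in> bounded_ops"
    and cinner_adj: "cinner (blinfun_apply x \<xi>) \<eta> = cinner \<xi> (blinfun_apply (adj x) \<eta>)"
proof -
  have "\<exists>!y. y \<in> bounded_ops \<and>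
      (\<forall>\<xi> \<eta>. cinner (blinfun_apply x \<xi>) \<eta> = cinner \<xi> (blinfun_apply y \<eta>))"
    using adj_exists[OF assms] adj_unique[of x] by blast
  from theI'[OF this]
  show "adj x \<in> bounded_ops"
    and "cinner (blinfun_apply x \<xi>) \<eta> = cinner \<xi> (blinfun_apply (adj x) \<eta>)"
    unfolding adj_def by blast+
qed


section \<open>Von Neumann algebras and their preduals\<close>

definition commutant :: "('h :: chilbert_space) operator set \<Rightarrow> 'h operator set"
  where "commutant S = {y \<in> bounded_ops. \<forall>x\<in>S. y o\<^sub>L x = x o\<^sub>L y}"

definition von_neumann_algebra :: "('h :: chilbert_space) operator set \<Rightarrow> bool"
  where "von_neumann_algebra N \<longleftrightarrow>
    N \<subseteq> bounded_ops \<and> adj ` N \<subseteq> N \<and> commutant (commutant N) = N"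

text \<open>Functionals on \<open>N\<close> and maps between algebras are total functions on operators of which
  only the values on the algebra matter.\<close>

definition predual :: "('h :: chilbert_space) operator set \<Rightarrow> ('h operator \<Rightarrow> complex) set"
  where "predual N = {\<omega>. \<exists>\<xi> \<eta> :: nat \<Rightarrow> 'h.
    summable (\<lambda>n. (norm (\<xi> n))\<^sup>2) \<and> summable (\<lambda>n. (norm (\<eta> n))\<^sup>2) \<and>
    (\<forall>x\<in>N. (\<lambda>n. cinner (blinfun_apply x (\<xi> n)) (\<eta> n)) sums \<omega> x)}"

definition separable_predual :: "('h :: chilbert_space) operator set \<Rightarrow> bool"
  where "separable_predual N \<longleftrightarrow> (\<exists>D. countable D \<and> D \<subseteq> predual N \<and>
    (\<forall>\<omega>\<in>predual N. \<forall>e>0. \<exists>\<delta>\<in>D. \<forall>x\<in>N. cmod (\<omega> x - \<delta> x) \<le> e * norm x))"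

definition linear_on_algebra ::
    "('h :: chilbert_space) operator set \<Rightarrow> ('h operator \<Rightarrow> 'b :: complex_vector) \<Rightarrow> bool"
  where "linear_on_algebra N f \<longleftrightarrow>
    (\<forall>x\<in>N. \<forall>y\<in>N. f (x + y) = f x + f y) \<and> (\<forall>c. \<forall>x\<in>N. f (c *\<^sub>C x) = c *\<^sub>C f x)"

definition faithful_normal_state ::
    "('h :: chilbert_space) operator set \<Rightarrow> ('h operator \<Rightarrow> complex) \<Rightarrow> bool"
  where "faithful_normal_state N \<rho> \<longleftrightarrow>
    linear_on_algebra N \<rho> \<and>
    (\<forall>x\<in>N. \<rho> (adj x o\<^sub>L x) \<in> \<real>\<^sub>\<ge>\<^sub>0) \<and>
    \<rho> id_blinfun = 1 \<and>
    (\<forall>x\<in>N. \<rho> (adj x o\<^sub>L x) = 0 \<longrightarrow> x = 0) \<and>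
    \<rho> \<in> predual N"


section \<open>Spectral measures\<close>

text \<open>A Hilbert space is given here by a carrier \<open>K\<close> and an inner product \<open>ip\<close>. The condition
  \<open>ip (E B f) g = ip f (E B g)\<close> together with multiplicativity makes every \<open>E B\<close> an orthogonal
  projection (in particular linear) on \<open>K\<close>.\<close>

definition spectral_measure ::
    "'v set \<Rightarrow> ('v \<Rightarrow> 'v \<Rightarrow> complex) \<Rightarrow> (real set \<Rightarrow> 'v \<Rightarrow> 'v) \<Rightarrow> bool"
  where "spectral_measure K ip E \<longleftrightarrow>
    (\<forall>B\<in>sets borel. \<forall>f\<in>K. E B f \<in> K \<and> (\<forall>g\<in>K. ip (E B f) g = ip f (E B g))) \<and>
    (\<forall>A\<in>sets borel. \<forall>B\<in>sets borel. \<forall>f\<in>K. E (A \<inter> B) f = E A (E B f)) \<and>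
    (\<forall>f\<in>K. E UNIV f = f) \<and>
    (\<forall>f\<in>K. \<forall>B :: nat \<Rightarrow> real set. range B \<subseteq> sets borel \<longrightarrow> disjoint_family B \<longrightarrow>
      (\<lambda>n. ip (E (B n) f) f) sums ip (E (\<Union>n. B n) f) f)"

definition scalar_measure ::
    "('v \<Rightarrow> 'v \<Rightarrow> complex) \<Rightarrow> (real set \<Rightarrow> 'v \<Rightarrow> 'v) \<Rightarrow> 'v \<Rightarrow> real measure"
  where "scalar_measure ip E f =
    measure_of UNIV (sets borel) (\<lambda>B. ennreal (Re (ip (E B f) f)))"

text \<open>\<open>E\<close> is the spectral measure of the linear operator with graph \<open>A\<close>: the domain of \<open>A\<close> is the
  set of vectors \<open>f\<close> for which \<open>s\<^sup>2\<close> is integrable, and on it the quadratic form of \<open>A\<close>, hence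
  (by polarization) \<open>A\<close> itself, is that of \<open>\<integral> s dE(s)\<close>.\<close>

definition is_spectral_measure_of ::
    "'v set \<Rightarrow> ('v \<Rightarrow> 'v \<Rightarrow> complex) \<Rightarrow> ('v \<times> 'v) set \<Rightarrow> (real set \<Rightarrow> 'v \<Rightarrow> 'v) \<Rightarrow> bool"
  where "is_spectral_measure_of K ip A E \<longleftrightarrow>
    spectral_measure K ip E \<and>
    (\<forall>f\<in>K. f \<in> Domain A \<longleftrightarrow> integrable (scalar_measure ip E f) (\<lambda>s. s\<^sup>2)) \<and>
    (\<forall>(f, h)\<in>A. ip h f = complex_of_real (\<integral>s. s \<partial>scalar_measure ip E f))"


section \<open>The GNS Hilbert space of a faithful state\<close>

text \<open>The completion of \<open>N\<close> for the inner product \<open>(x, y) \<mapsto> \<rho> (y\<^sup>* x)\<close> is realized, via the Riesz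
  representation, as the space of its bounded antilinear functionals: the vector \<open>v\<close> is the
  function \<open>y \<mapsto> \<langle>v, y\<rangle>\<close> on \<open>N\<close>, extended by \<open>0\<close> outside \<open>N\<close>. So \<open>gns_vec N \<rho> x\<close> is the class of
  \<open>x\<close>, the cyclic vector is \<open>gns_vec N \<rho> id_blinfun\<close>, and \<open>gns_rep\<close> is left multiplication.\<close>

definition gns_space ::
    "('h :: chilbert_space) operator set \<Rightarrow> ('h operator \<Rightarrow> complex) \<Rightarrow> ('h operator \<Rightarrow> complex) set"
  where "gns_space N \<rho> = {f.
    (\<forall>y. y \<notin> N \<longrightarrow> f y = 0) \<and>
    (\<forall>x\<in>N. \<forall>y\<in>N. f (x + y) = f x + f y) \<and>
    (\<forall>c. \<forall>y\<in>N. f (c *\<^sub>C y) = cnj c * f y) \<and>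
    (\<exists>C. \<forall>y\<in>N. (cmod (f y))\<^sup>2 \<le> C * Re (\<rho> (adj y o\<^sub>L y)))}"

definition gns_norm ::
    "('h :: chilbert_space) operator set \<Rightarrow> ('h operator \<Rightarrow> complex) \<Rightarrow> ('h operator \<Rightarrow> complex) \<Rightarrow> real"
  where "gns_norm N \<rho> f = (SUP y\<in>{y \<in> N. Re (\<rho> (adj y o\<^sub>L y)) \<le> 1}. cmod (f y))"

definition polarization ::
    "(('a \<Rightarrow> complex) \<Rightarrow> complex) \<Rightarrow> ('a \<Rightarrow> complex) \<Rightarrow> ('a \<Rightarrow> complex) \<Rightarrow> complex"
  where "polarization Q f g = (\<Sum>k<4::nat. \<i> ^ k * Q (\<lambda>y. f y + \<i> ^ k * g y)) / 4"

definition gns_inner ::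
    "('h :: chilbert_space) operator set \<Rightarrow> ('h operator \<Rightarrow> complex) \<Rightarrow>
      ('h operator \<Rightarrow> complex) \<Rightarrow> ('h operator \<Rightarrow> complex) \<Rightarrow> complex"
  where "gns_inner N \<rho> = polarization (\<lambda>f. complex_of_real ((gns_norm N \<rho> f)\<^sup>2))"

definition gns_vec ::
    "('h :: chilbert_space) operator set \<Rightarrow> ('h operator \<Rightarrow> complex) \<Rightarrow>
      'h operator \<Rightarrow> 'h operator \<Rightarrow> complex"
  where "gns_vec N \<rho> x = (\<lambda>y. if y \<in> N then \<rho> (adj y o\<^sub>L x) else 0)"

definition gns_rep ::
    "('h :: chilbert_space) operator set \<Rightarrow> 'h operator \<Rightarrow>
      ('h operator \<Rightarrow> complex) \<Rightarrow> 'h operator \<Rightarrow> complex"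
  where "gns_rep N a f = (\<lambda>y. if y \<in> N then f (adj a o\<^sub>L y) else 0)"


section \<open>The modular automorphism group\<close>

text \<open>Graph of the closure \<open>S\<close> of the antilinear operator \<open>x \<Omega> \<mapsto> x\<^sup>* \<Omega>\<close>.\<close>

definition tomita_S ::
    "('h :: chilbert_space) operator set \<Rightarrow> ('h operator \<Rightarrow> complex) \<Rightarrow>
      (('h operator \<Rightarrow> complex) \<times> ('h operator \<Rightarrow> complex)) set"
  where "tomita_S N \<rho> = {(f, g). f \<in> gns_space N \<rho> \<and> g \<in> gns_space N \<rho> \<and>
    (\<forall>e>0. \<exists>x\<in>N. gns_norm N \<rho> (\<lambda>y. f y - gns_vec N \<rho> x y) < e \<and>
                 gns_norm N \<rho> (\<lambda>y. g y - gns_vec N \<rho> (adj x) y) < e)}"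

text \<open>Graph of the adjoint of \<open>S\<close>; for an antilinear operator the defining relation is
  \<open>\<langle>S f, g\<rangle> = \<langle>S\<^sup>* g, f\<rangle>\<close>.\<close>

definition tomita_F ::
    "('h :: chilbert_space) operator set \<Rightarrow> ('h operator \<Rightarrow> complex) \<Rightarrow>
      (('h operator \<Rightarrow> complex) \<times> ('h operator \<Rightarrow> complex)) set"
  where "tomita_F N \<rho> = {(g, h). g \<in> gns_space N \<rho> \<and> h \<in> gns_space N \<rho> \<and>
    (\<forall>(f, f')\<in>tomita_S N \<rho>. gns_inner N \<rho> f' g = gns_inner N \<rho> h f)}"

text \<open>Graph of the modular operator \<open>\<Delta> = S\<^sup>* S\<close>.\<close>

definition modular_operator ::
    "('h :: chilbert_space) operator set \<Rightarrow> ('h operator \<Rightarrow> complex) \<Rightarrow>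
      (('h operator \<Rightarrow> complex) \<times> ('h operator \<Rightarrow> complex)) set"
  where "modular_operator N \<rho> = tomita_S N \<rho> O tomita_F N \<rho>"

definition modular_spectral_measure ::
    "('h :: chilbert_space) operator set \<Rightarrow> ('h operator \<Rightarrow> complex) \<Rightarrow>
      real set \<Rightarrow> ('h operator \<Rightarrow> complex) \<Rightarrow> ('h operator \<Rightarrow> complex)"
  where "modular_spectral_measure N \<rho> = (SOME E.
    is_spectral_measure_of (gns_space N \<rho>) (gns_inner N \<rho>) (modular_operator N \<rho>) E)"

text \<open>The unitary \<open>\<Delta>\<^bsup>it\<^esup> = \<integral> s\<^bsup>it\<^esup> dE(s)\<close>, with its matrix coefficients obtained from the quadratic
  form by polarization. Note that \<open>E\<close> is concentrated on the positive reals.\<close>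

definition modular_unitary ::
    "('h :: chilbert_space) operator set \<Rightarrow> ('h operator \<Rightarrow> complex) \<Rightarrow> real \<Rightarrow>
      ('h operator \<Rightarrow> complex) \<Rightarrow> ('h operator \<Rightarrow> complex)"
  where "modular_unitary N \<rho> t f = (THE h. h \<in> gns_space N \<rho> \<and>
    (\<forall>g\<in>gns_space N \<rho>. gns_inner N \<rho> h g =
      polarization
        (\<lambda>v. \<integral>s. complex_of_real s powr (\<i> * complex_of_real t)
               \<partial>scalar_measure (gns_inner N \<rho>) (modular_spectral_measure N \<rho>) v) f g))"

text \<open>\<open>\<sigma>\<^sub>t(x)\<close> is determined by \<open>\<pi>(\<sigma>\<^sub>t(x)) = \<Delta>\<^bsup>it\<^esup> \<pi>(x) \<Delta>\<^bsup>-it\<^esup>\<close>.\<close>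

definition modular_aut ::
    "('h :: chilbert_space) operator set \<Rightarrow> ('h operator \<Rightarrow> complex) \<Rightarrow> real \<Rightarrow>
      'h operator \<Rightarrow> 'h operator"
  where "modular_aut N \<rho> t x = (THE y. y \<in> N \<and>
    (\<forall>f\<in>gns_space N \<rho>. gns_rep N y f =
      modular_unitary N \<rho> t (gns_rep N x (modular_unitary N \<rho> (- t) f))))"


section \<open>Entire analytic elements\<close>

definition weak_star_entire ::
    "('h :: chilbert_space) operator set \<Rightarrow> (complex \<Rightarrow> 'h operator) \<Rightarrow> bool"
  where "weak_star_entire N F \<longleftrightarrow>
    (\<forall>z. F z \<in> N) \<and> (\<forall>\<omega>\<in>predual N. (\<lambda>z. \<omega> (F z)) holomorphic_on UNIV)"

definition is_entire_extension ::
    "('h :: chilbert_space) operator set \<Rightarrow> ('h operator \<Rightarrow> complex) \<Rightarrow> 'h operator \<Rightarrow>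
      (complex \<Rightarrow> 'h operator) \<Rightarrow> bool"
  where "is_entire_extension N \<rho> x F \<longleftrightarrow>
    weak_star_entire N F \<and> (\<forall>t :: real. F (\<i> * complex_of_real t) = modular_aut N \<rho> t x)"

definition entire_elements ::
    "('h :: chilbert_space) operator set \<Rightarrow> ('h operator \<Rightarrow> complex) \<Rightarrow> 'h operator set"
  where "entire_elements N \<rho> = {x \<in> N. \<exists>F. is_entire_extension N \<rho> x F}"

text \<open>The convention is \<open>\<sigma>\<^bsub>-iz\<^esub>(x) = F\<^sub>x(z)\<close>, that is \<open>\<sigma>\<^sub>w(x) = F\<^sub>x(i w)\<close>. Only meaningful for
  \<open>x\<close> in \<open>entire_elements N \<rho>\<close>.\<close>

definition modular_ext ::
    "('h :: chilbert_space) operator set \<Rightarrow> ('h operator \<Rightarrow> complex) \<Rightarrow> complex \<Rightarrow>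
      'h operator \<Rightarrow> 'h operator"
  where "modular_ext N \<rho> w x = (THE F. is_entire_extension N \<rho> x F) (\<i> * w)"


section \<open>Markov maps\<close>

text \<open>Positivity of an operator matrix \<open>(x\<^sub>i\<^sub>j)\<close>, \<open>i, j < n\<close>, acting on the \<open>n\<close>-fold direct sum of
  the Hilbert space.\<close>

definition positive_matrix :: "nat \<Rightarrow> (nat \<Rightarrow> nat \<Rightarrow> ('h :: chilbert_space) operator) \<Rightarrow> bool"
  where "positive_matrix n x \<longleftrightarrow> (\<forall>\<xi> :: nat \<Rightarrow> 'h.
    (\<Sum>i<n. \<Sum>j<n. cinner (blinfun_apply (x i j) (\<xi> j)) (\<xi> i)) \<in> \<real>\<^sub>\<ge>\<^sub>0)"

definition completely_positive_on ::
    "('h :: chilbert_space) operator set \<Rightarrow> ('h operator \<Rightarrow> ('k :: chilbert_space) operator) \<Rightarrow> bool"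
  where "completely_positive_on N \<Phi> \<longleftrightarrow>
    (\<forall>n x. (\<forall>i<n. \<forall>j<n. x i j \<in> N) \<longrightarrow> positive_matrix n x \<longrightarrow>
      positive_matrix n (\<lambda>i j. \<Phi> (x i j)))"

definition markov_map ::
    "('h :: chilbert_space) operator set \<Rightarrow> ('h operator \<Rightarrow> complex) \<Rightarrow>
     ('k :: chilbert_space) operator set \<Rightarrow> ('k operator \<Rightarrow> complex) \<Rightarrow>
     ('h operator \<Rightarrow> 'k operator) \<Rightarrow> bool"
  where "markov_map N \<rho> M \<phi> \<Phi> \<longleftrightarrow>
    \<Phi> ` N \<subseteq> M \<and>
    linear_on_algebra N \<Phi> \<and>
    \<Phi> id_blinfun = id_blinfun \<and>
    completely_positive_on N \<Phi> \<and>
    (\<forall>x\<in>N. \<phi> (\<Phi> x) = \<rho> x) \<and>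
    (\<forall>t. \<forall>x\<in>N. modular_aut M \<phi> t (\<Phi> x) = \<Phi> (modular_aut N \<rho> t x))"

end

(* A weak-* entire function F is norm entire: by uniform boundedness it is norm bounded on discs, and
   then Cauchy's estimates for the functions z \<mapsto> \<langle>F z \<xi>, \<eta>\<rangle> make its difference quotients norm Cauchy.
   A unital completely positive map \<Phi> is norm bounded, so \<Phi> \<circ> F is again weak-* entire, without any
   appeal to normality of \<Phi>. On the imaginary axis \<Phi> \<circ> F is the modular orbit of \<Phi> x, and entire
   extensions are unique by the identity theorem. *)
theory Submission
  imports Defs "HOL-Complex_Analysis.Conformal_Mappings"
begin

section \<open>Uniform boundedness and difference quotients\<close>

text \<open>Baire category: the closed sets \<open>A n\<close> cover a complete space, so one of
  them contains a ball, and differences of points of that ball reach every direction. The codomain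
  is general so that functionals and operators are both covered.\<close>

lemma uniform_boundedness:
  fixes T :: "'i \<Rightarrow> 'a :: {real_normed_vector, complete_space} \<Rightarrow>\<^sub>L 'b :: real_normed_vector"
  assumes pointwise: "\<And>x. bounded ((\<lambda>i. blinfun_apply (T i) x) ` I)"
  shows "bounded (T ` I)"
proof -
  define A where "A n = {x. \<forall>i\<in>I. norm (blinfun_apply (T i) x) \<le> real n}" for n :: nat
  have "A n = (\<Inter>i\<in>I. {x. norm (blinfun_apply (T i) x) \<le> real n})" for n
    by (auto simp: A_def)
  then have closed: "closed (A n)" for n
    by (auto intro!: closed_INT closed_Collect_le continuous_intros)
  have cover: "(\<Union>n. A n) = UNIV"
  proof -
    have "\<exists>n. x \<in> A n" for x
    proof -
      obtain b where b: "\<And>i. i \<in> I \<Longrightarrow> norm (blinfun_apply (T i) x) \<le> b"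
        using pointwise[of x] by (auto simp: bounded_iff)
      obtain n :: nat where "b \<le> real n" using real_arch_simple by blast
      then show ?thesis using order_trans[OF b] unfolding A_def by blast
    qed
    then show ?thesis by auto
  qed
  have "\<exists>n. interior (A n) \<noteq> {}"
  proof (rule ccontr)
    assume "\<nexists>n. interior (A n) \<noteq> {}"
    then have "interior (\<Union>(range A)) = {}"
      using Met_TC.metric_Baire_category_alt[where 'a = 'a, of "range A"] closed
      by (auto simp: complete_UNIV)
    then show False by (simp add: cover)
  qed
  then obtain n x where "x \<in> interior (A n)" by blast
  then obtain e where e: "e > 0" "cball x e \<subseteq> A n"
    by (meson mem_interior_cball)
  have "norm (T i) \<le> 2 * real n / e" if i: "i \<in> I" for i
  proof (rule norm_blinfun_bound)
    fix y
    show "norm (blinfun_apply (T i) y) \<le> 2 * real n / e * norm y"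
    proof (cases "y = 0")
      case False
      \<comment> \<open>This scaling puts \<open>x + s *\<^sub>R y\<close> on the boundary of the
        ball, so that it and \<open>x\<close> both lie in \<open>A n\<close>. Two bounds by
        \<open>real n\<close> over the radius \<open>e\<close> give the constant
        \<open>2 * real n / e\<close>.\<close>
      define s where "s = e / norm y"
      have s: "s > 0" using e False by (simp add: s_def)
      have "x + s *\<^sub>R y \<in> A n" "x \<in> A n"
        using e False by (auto simp: s_def dist_norm subset_iff)
      then have "norm (blinfun_apply (T i) (x + s *\<^sub>R y) - blinfun_apply (T i) x) \<le> real n + real n"
        using i by (intro norm_triangle_le_diff add_mono) (auto simp: A_def)
      then have "s * norm (blinfun_apply (T i) y) \<le> 2 * real n"
        using s by (simp add: blinfun.add_right blinfun.scaleR_right)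
      then show ?thesis using False e by (simp add: s_def field_simps)
    qed simp
  qed (use e in simp)
  then show ?thesis by (auto simp: bounded_iff)
qed

text \<open>First-order Taylor expansion, with the second derivative controlled by Cauchy's
  inequality. The point is that \<open>f\<close> enters the bound through \<open>C\<close> alone, so
  the estimate is uniform over families with a common bound.\<close>

lemma holomorphic_difference_quotient:
  assumes f: "f holomorphic_on UNIV"
    and bound: "\<And>w. w \<in> cball z 2 \<Longrightarrow> cmod (f w) \<le> C"
    and h: "h \<noteq> 0" "cmod h \<le> 1"
  shows "cmod ((f (z + h) - f z) / h - deriv f z) \<le> 2 * C * cmod h"
proof -
  have holo: "(deriv ^^ n) f holomorphic_on UNIV" for n
    using f by (rule holomorphic_higher_deriv) simp
  have "cmod ((deriv ^^ 0) f (z + h) - (\<Sum>i\<le>1. (deriv ^^ i) f z * (z + h - z) ^ i / fact i))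
      \<le> (2 * C) * cmod (z + h - z) ^ Suc 1 / fact 1"
  proof (rule complex_Taylor[where S = "cball z 1"])
    show "((deriv ^^ i) f has_field_derivative (deriv ^^ Suc i) f x) (at x within cball z 1)" for i x
      using holomorphic_derivI[OF holo[of i], of x]
      by (auto intro: has_field_derivative_at_within)
    fix x assume x: "x \<in> cball z 1"
    \<comment> \<open>Unit circles around points of \<open>cball z 1\<close> stay inside
      \<open>cball z 2\<close>, which explains the radius in the assumption
      \<open>bound\<close>.\<close>
    have "cmod ((deriv ^^ 2) f x) \<le> fact 2 * C / 1 ^ 2"
    proof (rule Cauchy_inequality)
      show "cmod (f w) \<le> C" if "cmod (x - w) = 1" for w
        using x that dist_triangle[of z w x] by (intro bound) (auto simp: dist_norm)
      show "f holomorphic_on ball x 1" "continuous_on (cball x 1) f"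
        using f holomorphic_on_subset holomorphic_on_imp_continuous_on by blast+
    qed simp
    then show "cmod ((deriv ^^ Suc 1) f x) \<le> 2 * C"
      by (simp add: numeral_2_eq_2)
  qed (use h in \<open>auto simp: dist_norm\<close>)
  then have "cmod (f (z + h) - f z - deriv f z * h) \<le> 2 * C * cmod h * cmod h"
    by (simp add: diff_diff_eq power2_eq_square mult.assoc)
  moreover have "(f (z + h) - f z) / h - deriv f z = (f (z + h) - f z - deriv f z * h) / h"
    using h by (simp add: field_simps)
  ultimately show ?thesis using h by (simp add: norm_divide divide_le_eq)
qed

text \<open>Completeness of the complex plane supplies the derivative as a limit of difference
  quotients, so differentiability follows without a candidate for its value.\<close>

lemma field_differentiable_if_Cauchy_quotients:
  fixes f :: "complex \<Rightarrow> complex"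
  assumes Cauchy_quotients: "\<And>h k. h \<noteq> 0 \<Longrightarrow> k \<noteq> 0 \<Longrightarrow> cmod h \<le> 1 \<Longrightarrow> cmod k \<le> 1 \<Longrightarrow>
    cmod ((f (z + h) - f z) / h - (f (z + k) - f z) / k) \<le> K * (cmod h + cmod k)"
  shows "f field_differentiable (at z)"
proof -
  define q where "q h = (f (z + h) - f z) / h" for h
  \<comment> \<open>\<open>Suc n\<close> keeps every term nonzero and of modulus at most 1, the
    first one included, so the estimate on quotients applies to all of them.\<close>
  define a where "a n = complex_of_real (1 / real (Suc n))" for n
  have a: "a n \<noteq> 0" "cmod (a n) \<le> 1" "cmod (a n) = 1 / real (Suc n)" for n
    unfolding a_def norm_of_real of_real_eq_0_iff by (simp_all add: divide_le_eq)
  have a0: "(\<lambda>n. cmod (a n)) \<longlonglongrightarrow> 0"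
    unfolding a(3) by (rule LIMSEQ_Suc[OF lim_1_over_n])
  have q: "cmod (q h - q k) \<le> K * (cmod h + cmod k)"
    if "h \<noteq> 0" "k \<noteq> 0" "cmod h \<le> 1" "cmod k \<le> 1" for h k
    unfolding q_def using that by (rule Cauchy_quotients)
  have K: "0 \<le> K" using q[of 1 1] by simp
  have "Cauchy (\<lambda>n. q (a n))"
  proof (rule CauchyI)
    fix e :: real assume e: "e > 0"
    have "(\<lambda>n. K * cmod (a n)) \<longlonglongrightarrow> K * 0"
      by (intro tendsto_intros a0)
    then have "\<forall>\<^sub>F n in sequentially. K * cmod (a n) < e / 2"
      using e by (intro order_tendstoD) auto
    then obtain n0 where n0: "\<And>n. n \<ge> n0 \<Longrightarrow> K * cmod (a n) < e / 2"
      by (auto simp: eventually_sequentially)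
    have "cmod (q (a m) - q (a n)) < e" if "m \<ge> n0" "n \<ge> n0" for m n
      using q[OF a(1) a(1) a(2) a(2), of m n] n0[OF that(1)] n0[OF that(2)]
      unfolding distrib_left by linarith
    then show "\<exists>M. \<forall>m\<ge>M. \<forall>n\<ge>M. cmod (q (a m) - q (a n)) < e" by blast
  qed
  then obtain l where l: "(\<lambda>n. q (a n)) \<longlonglongrightarrow> l"
    using Cauchy_convergent convergent_def by blast
  \<comment> \<open>Letting \<open>k\<close> run through the sequence \<open>a\<close> turns the
    Cauchy estimate into a linear rate of convergence to \<open>l\<close>.\<close>
  have bound: "cmod (q h - l) \<le> K * cmod h" if h: "h \<noteq> 0" "cmod h \<le> 1" for h
  proof (rule LIMSEQ_le)
    show "(\<lambda>n. cmod (q h - q (a n))) \<longlonglongrightarrow> cmod (q h - l)"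
      by (intro tendsto_intros l)
    have "(\<lambda>n. K * (cmod h + cmod (a n))) \<longlonglongrightarrow> K * (cmod h + 0)"
      by (intro tendsto_intros a0)
    then show "(\<lambda>n. K * (cmod h + cmod (a n))) \<longlonglongrightarrow> K * cmod h" by simp
    show "\<exists>N. \<forall>n\<ge>N. cmod (q h - q (a n)) \<le> K * (cmod h + cmod (a n))"
      using q h a by blast
  qed
  have "((\<lambda>h. q h - l) \<longlongrightarrow> 0) (at 0)"
  proof (rule Lim_null_comparison)
    have "\<forall>\<^sub>F h in at 0. h \<noteq> 0 \<and> cmod h \<le> 1"
      unfolding eventually_at by (rule exI[of _ 1]) simp
    then show "\<forall>\<^sub>F h in at 0. cmod (q h - l) \<le> K * cmod h"
      by eventually_elim (use bound in blast)
    show "((\<lambda>h. K * cmod h) \<longlongrightarrow> 0) (at 0)"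
      by (auto intro!: tendsto_eq_intros)
  qed
  then have "(f has_field_derivative l) (at z)"
    unfolding DERIV_def q_def by (simp add: Lim_null[symmetric])
  then show ?thesis by (auto simp: field_differentiable_def)
qed


section \<open>Operators on a complex Hilbert space\<close>

lemma scaleC_blinfun_apply [simp]:
  "blinfun_apply (c *\<^sub>C (x :: 'a :: real_normed_vector \<Rightarrow>\<^sub>L 'b :: complex_inner)) \<xi> =
    c *\<^sub>C blinfun_apply x \<xi>"
  by transfer simp

lemma minus_one_scaleC: "(- 1) *\<^sub>C x = - (x :: 'a :: complex_vector)"
  using scaleR_scaleC[of "- 1" x] by simp

lemma cinner_diff_left: "cinner (x - y) z = cinner x z - cinner y (z :: 'a :: complex_inner)"
  using cinner_add_left[of "x - y" y z] by simp

lemma norm_le_if_cinner_le: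
  fixes v :: "'a :: complex_inner"
  assumes "\<And>\<eta>. cmod (cinner v \<eta>) \<le> B * norm \<eta>" and "0 \<le> B"
  shows "norm v \<le> B"
proof (cases "v = 0")
  case False
  have "cmod (cinner v v) = norm v * norm v"
    unfolding cinner_self norm_of_real by (simp add: power2_eq_square)
  then show ?thesis using assms(1)[of v] False by simp
qed (use assms in simp)

lemma norm_operator_le:
  fixes T :: "'h :: chilbert_space operator"
  assumes "\<And>\<xi> \<eta>. cmod (cinner (blinfun_apply T \<xi>) \<eta>) \<le> B * norm \<xi> * norm \<eta>" and "0 \<le> B"
  shows "norm T \<le> B"
  by (rule norm_blinfun_bound[OF _ norm_le_if_cinner_le]) (use assms in simp_all)

text \<open>Uniform boundedness is used twice: for fixed \<open>\<xi>\<close> on the functionals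
  given by pairing with \<open>F i \<xi>\<close>, whose norms control that vector, and then on the
  operators themselves. The vector sits in the second slot because the inner product is linear in
  the first.\<close>

lemma weakly_bounded_operators_bounded:
  fixes F :: "'i \<Rightarrow> 'h :: chilbert_space operator"
  assumes weak: "\<And>\<xi> \<eta>. bounded ((\<lambda>i. cinner (blinfun_apply (F i) \<xi>) \<eta>) ` I)"
  shows "bounded (F ` I)"
proof (rule uniform_boundedness)
  fix \<xi>
  define v where "v i = blinfun_apply (F i) \<xi>" for i
  define T where "T i = Blinfun (\<lambda>\<eta>. cinner \<eta> (v i))" for i
  have "bounded_linear (\<lambda>\<eta>. cinner \<eta> (v i))" for i
    by (rule bounded_linear_intro[where K = "norm (v i)"])
      (auto simp: cinner_add_left cinner_scaleR_left scaleR_conv_of_real cmod_cinner_le)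
  then have T: "blinfun_apply (T i) \<eta> = cinner \<eta> (v i)" for i \<eta>
    by (simp add: T_def bounded_linear_Blinfun_apply)
  have cmod_T: "cmod (blinfun_apply (T i) \<eta>) = cmod (cinner (v i) \<eta>)" for i \<eta>
    unfolding T by (subst cinner_commute) simp
  have "bounded (T ` I)"
  proof (rule uniform_boundedness)
    show "bounded ((\<lambda>i. blinfun_apply (T i) \<eta>) ` I)" for \<eta>
      using weak[of \<xi> \<eta>] by (auto simp: bounded_iff cmod_T v_def)
  qed
  then obtain B where B: "\<And>i. i \<in> I \<Longrightarrow> norm (T i) \<le> B"
    by (auto simp: bounded_iff)
  have "norm (v i) \<le> B" if "i \<in> I" for i
  proof (rule norm_le_if_cinner_le)
    show "cmod (cinner (v i) \<eta>) \<le> B * norm \<eta>" for \<eta>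
      using order_trans[OF norm_blinfun mult_right_mono[OF B[OF that] norm_ge_zero]]
      by (simp add: cmod_T[symmetric])
    show "0 \<le> B" using order_trans[OF norm_ge_zero B[OF that]] .
  qed
  then show "bounded ((\<lambda>i. blinfun_apply (F i) \<xi>) ` I)"
    by (auto simp: bounded_iff v_def)
qed


section \<open>Von Neumann algebras and weak-* entire functions\<close>

lemma id_in_commutant: "id_blinfun \<in> commutant (S :: 'h :: chilbert_space operator set)"
  by (auto simp: commutant_def bounded_ops_def intro!: blinfun_eqI)

lemma add_in_commutant:
  fixes S :: "'h :: chilbert_space operator set"
  assumes "x \<in> commutant S" and "y \<in> commutant S"
  shows "x + y \<in> commutant S"
proof -
  note compose_add = bounded_bilinear.add_left[OF bounded_bilinear_blinfun_compose]
    bounded_bilinear.add_right[OF bounded_bilinear_blinfun_compose]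
  show ?thesis
    using assms by (simp add: commutant_def bounded_ops_def compose_add blinfun.add_left
        scaleC_add_right)
qed

text \<open>The operator type contains all bounded real-linear maps, and complex scalars can be
  moved past \<open>y\<close> only if \<open>y\<close> is complex-linear; hence the condition
  \<open>S \<subseteq> bounded_ops\<close>.\<close>

lemma scaleC_in_commutant:
  fixes S :: "'h :: chilbert_space operator set"
  assumes S: "S \<subseteq> bounded_ops" and x: "x \<in> commutant S"
  shows "c *\<^sub>C x \<in> commutant S"
proof -
  have commute: "x o\<^sub>L y = y o\<^sub>L x" if "y \<in> S" for y
    using x that by (simp add: commutant_def)
  have "(c *\<^sub>C x) o\<^sub>L y = y o\<^sub>L (c *\<^sub>C x)" if y: "y \<in> S" for y
  proof (rule blinfun_eqI)
    fix \<xi>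
    have "blinfun_apply x (blinfun_apply y \<xi>) = blinfun_apply y (blinfun_apply x \<xi>)"
      using arg_cong[OF commute[OF y], of "\<lambda>u. blinfun_apply u \<xi>"] by simp
    moreover have "blinfun_apply y (c *\<^sub>C v) = c *\<^sub>C blinfun_apply y v" for v
      using S y by (auto simp: bounded_ops_def)
    ultimately show "blinfun_apply ((c *\<^sub>C x) o\<^sub>L y) \<xi> = blinfun_apply (y o\<^sub>L (c *\<^sub>C x)) \<xi>"
      by simp
  qed
  moreover have "x \<in> bounded_ops" using x by (simp add: commutant_def)
  then have "c *\<^sub>C x \<in> bounded_ops" by (simp add: bounded_ops_def scaleC_scaleC mult.commute)
  ultimately show ?thesis unfolding commutant_def by blast
qed

text \<open>By the bicommutant identity \<open>N\<close> is itself a commutant, so it inherits the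
  closure properties of commutants.\<close>

lemma
  assumes N: "von_neumann_algebra N"
  shows id_in_von_neumann_algebra: "id_blinfun \<in> N"
    and add_in_von_neumann_algebra: "x \<in> N \<Longrightarrow> y \<in> N \<Longrightarrow> x + y \<in> N"
    and scaleC_in_von_neumann_algebra: "x \<in> N \<Longrightarrow> c *\<^sub>C x \<in> N"
proof -
  have eq: "commutant (commutant N) = N" using N by (simp add: von_neumann_algebra_def)
  show "id_blinfun \<in> N" using id_in_commutant[of "commutant N"] eq by simp
  show "x \<in> N \<Longrightarrow> y \<in> N \<Longrightarrow> x + y \<in> N"
    using add_in_commutant[of x "commutant N" y] eq by simp
  have "commutant N \<subseteq> bounded_ops" by (auto simp: commutant_def)
  then show "x \<in> N \<Longrightarrow> c *\<^sub>C x \<in> N"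
    using scaleC_in_commutant[of "commutant N" x c] eq by simp
qed

lemma diff_in_von_neumann_algebra:
  assumes N: "von_neumann_algebra N" and "x \<in> N" "y \<in> N"
  shows "x - y \<in> N"
  using add_in_von_neumann_algebra[OF N assms(2) scaleC_in_von_neumann_algebra[OF N assms(3)], of "- 1"]
  by (simp add: minus_one_scaleC)

lemma linear_on_algebra_diff:
  assumes f: "linear_on_algebra N f" and N: "von_neumann_algebra N" and xy: "x \<in> N" "y \<in> N"
  shows "f (x - y) = f x - f y"
proof -
  have "f (x - y + y) = f (x - y) + f y"
    using f diff_in_von_neumann_algebra[OF N xy] xy(2) unfolding linear_on_algebra_def by blast
  then show ?thesis by simp
qed

lemma vector_functional_in_predual: "(\<lambda>x. cinner (blinfun_apply x \<xi>) \<eta>) \<in> predual N"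
proof -
  have "summable (\<lambda>n. (norm (if n = (0 :: nat) then v else 0))\<^sup>2)" for v :: 'a
    by (rule summable_finite[of "{0}"]) auto
  moreover have "(\<lambda>n. cinner (blinfun_apply x (if n = (0 :: nat) then \<xi> else 0))
      (if n = 0 then \<eta> else 0)) sums cinner (blinfun_apply x \<xi>) \<eta>" for x
    using sums_single[of 0 "\<lambda>_. cinner (blinfun_apply x \<xi>) \<eta>"]
    by (rule back_subst[of "\<lambda>g. g sums _"]) auto
  ultimately show ?thesis
    unfolding predual_def
    by (intro CollectI exI[of _ "\<lambda>n. if n = 0 then \<xi> else 0"]
        exI[of _ "\<lambda>n. if n = 0 then \<eta> else 0"]) simp
qed

lemma predual_linear:
  assumes N: "von_neumann_algebra N" and "\<omega> \<in> predual N"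
  shows "linear_on_algebra N \<omega>"
proof -
  obtain \<xi> \<eta> where \<omega>: "\<And>x. x \<in> N \<Longrightarrow> (\<lambda>n. cinner (blinfun_apply x (\<xi> n)) (\<eta> n)) sums \<omega> x"
    using assms(2) unfolding predual_def by blast
  have "\<omega> (x + y) = \<omega> x + \<omega> y" if "x \<in> N" "y \<in> N" for x y
    using \<omega>[OF add_in_von_neumann_algebra[OF N that]] sums_add[OF \<omega>[OF that(1)] \<omega>[OF that(2)]]
    by (simp add: blinfun.add_left cinner_add_left sums_unique2)
  moreover have "\<omega> (c *\<^sub>C x) = c *\<^sub>C \<omega> x" if "x \<in> N" for c x
    using \<omega>[OF scaleC_in_von_neumann_algebra[OF N that, of c]] sums_mult[OF \<omega>[OF that], of c]
    by (simp add: cinner_scaleC_left scaleC_complex_def sums_unique2)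
  ultimately show ?thesis by (simp add: linear_on_algebra_def)
qed

text \<open>Each term is dominated through \<open>a * b \<le> a\<^sup>2 + b\<^sup>2\<close> by a
  summable series, whose sum serves as the bound.\<close>

lemma predual_bounded:
  assumes "\<omega> \<in> predual N"
  obtains B where "0 \<le> B" "\<And>x. x \<in> N \<Longrightarrow> cmod (\<omega> x) \<le> B * norm x"
proof -
  obtain \<xi> \<eta> where sq: "summable (\<lambda>n. (norm (\<xi> n))\<^sup>2)" "summable (\<lambda>n. (norm (\<eta> n))\<^sup>2)"
    and sums: "\<And>x. x \<in> N \<Longrightarrow> (\<lambda>n. cinner (blinfun_apply x (\<xi> n)) (\<eta> n)) sums \<omega> x"
    using assms unfolding predual_def by blast
  define b where "b n = (norm (\<xi> n))\<^sup>2 + (norm (\<eta> n))\<^sup>2" for n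
  have b: "summable b" unfolding b_def by (intro summable_add sq)
  have b0: "0 \<le> b n" for n by (simp add: b_def)
  have "cmod (\<omega> x) \<le> suminf b * norm x" if "x \<in> N" for x
  proof -
    have le: "cmod (cinner (blinfun_apply x (\<xi> n)) (\<eta> n)) \<le> norm x * b n" for n
    proof -
      have "cmod (cinner (blinfun_apply x (\<xi> n)) (\<eta> n)) \<le> norm x * norm (\<xi> n) * norm (\<eta> n)"
        by (rule order_trans[OF cmod_cinner_le mult_right_mono[OF norm_blinfun]]) simp
      also have "norm (\<xi> n) * norm (\<eta> n) \<le> b n"
        using sum_squares_bound[of "norm (\<xi> n)" "norm (\<eta> n)"]
          mult_nonneg_nonneg[of "norm (\<xi> n)" "norm (\<eta> n)"]
        unfolding b_def by (simp del: mult_nonneg_nonneg)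
      then have "norm x * norm (\<xi> n) * norm (\<eta> n) \<le> norm x * b n"
        by (simp add: mult_left_mono mult.assoc)
      finally show ?thesis .
    qed
    have "norm (\<Sum>n. cinner (blinfun_apply x (\<xi> n)) (\<eta> n)) \<le> (\<Sum>n. norm x * b n)"
      by (rule norm_suminf_le[OF le summable_mult[OF b]])
    then show ?thesis
      using sums[OF that] b by (simp add: sums_iff suminf_mult mult.commute)
  qed
  then show thesis using that suminf_nonneg[OF b b0] by blast
qed

lemma weak_star_entire_vector_functional:
  "weak_star_entire N F \<Longrightarrow> (\<lambda>z. cinner (blinfun_apply (F z) \<xi>) \<eta>) holomorphic_on UNIV"
  unfolding weak_star_entire_def
  by (drule conjunct2, drule bspec[OF _ vector_functional_in_predual[of \<xi> \<eta>]])

text \<open>Matrix coefficients are continuous, hence bounded on a compact disc, and weak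
  boundedness of operators implies norm boundedness.\<close>

lemma weak_star_entire_bounded_on_cball:
  assumes "weak_star_entire N F"
  obtains C where "0 \<le> C" "\<And>w. w \<in> cball z r \<Longrightarrow> norm (F w) \<le> C"
proof -
  have "bounded (F ` cball z r)"
  proof (rule weakly_bounded_operators_bounded)
    show "bounded ((\<lambda>w. cinner (blinfun_apply (F w) \<xi>) \<eta>) ` cball z r)" for \<xi> \<eta>
      by (intro compact_imp_bounded compact_continuous_image holomorphic_on_imp_continuous_on
          holomorphic_on_subset[OF weak_star_entire_vector_functional[OF assms]]) auto
  qed
  then show thesis using that unfolding bounded_pos by (metis imageI less_imp_le)
qed

text \<open>The scalar estimate holds for every matrix coefficient with the bound
  \<open>C * norm \<xi> * norm \<eta>\<close>. This uniformity in the two vectors lifts it to the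
  operator norm.\<close>

lemma weak_star_entire_Cauchy_quotients:
  assumes F: "weak_star_entire N F"
  obtains K where "\<And>h k. h \<noteq> 0 \<Longrightarrow> k \<noteq> 0 \<Longrightarrow> cmod h \<le> 1 \<Longrightarrow> cmod k \<le> 1 \<Longrightarrow>
    norm (inverse h *\<^sub>C (F (z + h) - F z) - inverse k *\<^sub>C (F (z + k) - F z)) \<le> K * (cmod h + cmod k)"
proof -
  obtain C where C: "0 \<le> C" "\<And>w. w \<in> cball z 2 \<Longrightarrow> norm (F w) \<le> C"
    using weak_star_entire_bounded_on_cball[OF F] by blast
  have "norm (inverse h *\<^sub>C (F (z + h) - F z) - inverse k *\<^sub>C (F (z + k) - F z))
      \<le> 2 * C * (cmod h + cmod k)"
    if hk: "h \<noteq> 0" "k \<noteq> 0" "cmod h \<le> 1" "cmod k \<le> 1" for h k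
  proof (rule norm_operator_le)
    fix \<xi> \<eta>
    define f where "f w = cinner (blinfun_apply (F w) \<xi>) \<eta>" for w
    have f: "f holomorphic_on UNIV"
      unfolding f_def by (rule weak_star_entire_vector_functional[OF F])
    have bound: "cmod (f w) \<le> C * norm \<xi> * norm \<eta>" if "w \<in> cball z 2" for w
      unfolding f_def
      by (intro order_trans[OF cmod_cinner_le] mult_right_mono
          order_trans[OF norm_blinfun] C that) auto
    \<comment> \<open>Both quotients are compared with \<open>deriv f z\<close>, which cancels; the
      estimate thus involves values of \<open>F\<close> only.\<close>
    have "cmod ((f (z + h) - f z) / h - (f (z + k) - f z) / k)
        \<le> 2 * (C * norm \<xi> * norm \<eta>) * cmod h + 2 * (C * norm \<xi> * norm \<eta>) * cmod k"
      using norm_triangle_ineq4[of "(f (z + h) - f z) / h - deriv f z" "(f (z + k) - f z) / k - deriv f z"]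
        holomorphic_difference_quotient[where z = z, OF f bound hk(1,3)]
        holomorphic_difference_quotient[where z = z, OF f bound hk(2,4)]
      by simp
    moreover have "cinner (blinfun_apply (inverse h *\<^sub>C (F (z + h) - F z)
          - inverse k *\<^sub>C (F (z + k) - F z)) \<xi>) \<eta> = (f (z + h) - f z) / h - (f (z + k) - f z) / k"
      by (simp add: f_def blinfun.diff_left cinner_diff_left cinner_scaleC_left divide_inverse
          mult.commute)
    ultimately show "cmod (cinner (blinfun_apply (inverse h *\<^sub>C (F (z + h) - F z)
          - inverse k *\<^sub>C (F (z + k) - F z)) \<xi>) \<eta>) \<le> 2 * C * (cmod h + cmod k) * norm \<xi> * norm \<eta>"
      by (simp only:) (simp add: algebra_simps)
  qed (use C in simp)
  then show thesis using that by blast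
qed

text \<open>A norm bounded \<open>\<psi>\<close> carries the norm Cauchy estimate for the quotients
  of \<open>F\<close> over to those of \<open>\<psi> \<circ> F\<close>. It is stated for such
  functionals, beyond the predual, in order to apply to compositions of a normal functional with a
  Markov map.\<close>

lemma holomorphic_bounded_functional_weak_star_entire:
  assumes N: "von_neumann_algebra N" and F: "weak_star_entire N F"
    and lin: "linear_on_algebra N \<psi>" and bdd: "\<And>x. x \<in> N \<Longrightarrow> cmod (\<psi> x) \<le> B * norm x"
    and B: "0 \<le> B"
  shows "(\<lambda>z. \<psi> (F z)) holomorphic_on UNIV"
proof -
  have FN: "F w \<in> N" for w using F by (simp add: weak_star_entire_def)
  have "(\<lambda>z. \<psi> (F z)) field_differentiable (at z)" for z
  proof -
    define q where "q h = inverse h *\<^sub>C (F (z + h) - F z)" for h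
    obtain K where K: "\<And>h k. h \<noteq> 0 \<Longrightarrow> k \<noteq> 0 \<Longrightarrow> cmod h \<le> 1 \<Longrightarrow> cmod k \<le> 1 \<Longrightarrow>
        norm (q h - q k) \<le> K * (cmod h + cmod k)"
      unfolding q_def using weak_star_entire_Cauchy_quotients[OF F] by blast
    have qN: "q h \<in> N" for h
      unfolding q_def
      by (intro scaleC_in_von_neumann_algebra diff_in_von_neumann_algebra N FN)
    have \<psi>q: "\<psi> (q h) = (\<psi> (F (z + h)) - \<psi> (F z)) / h" for h
    proof -
      have "\<psi> (q h) = inverse h *\<^sub>C \<psi> (F (z + h) - F z)"
        using lin diff_in_von_neumann_algebra[OF N FN FN]
        unfolding linear_on_algebra_def q_def by blast
      then show ?thesis
        by (simp add: linear_on_algebra_diff[OF lin N FN FN] scaleC_complex_def divide_inverse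
            mult.commute)
    qed
    show ?thesis
    proof (rule field_differentiable_if_Cauchy_quotients)
      fix h k :: complex
      assume hk: "h \<noteq> 0" "k \<noteq> 0" "cmod h \<le> 1" "cmod k \<le> 1"
      have "cmod (\<psi> (q h) - \<psi> (q k)) = cmod (\<psi> (q h - q k))"
        by (simp add: linear_on_algebra_diff[OF lin N qN qN])
      also have "\<dots> \<le> B * norm (q h - q k)"
        by (intro bdd diff_in_von_neumann_algebra N qN)
      also have "\<dots> \<le> B * (K * (cmod h + cmod k))"
        by (intro mult_left_mono K hk B)
      finally show "cmod ((\<psi> (F (z + h)) - \<psi> (F z)) / h - (\<psi> (F (z + k)) - \<psi> (F z)) / k)
          \<le> (B * K) * (cmod h + cmod k)"
        by (simp add: \<psi>q mult.assoc)
    qed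
  qed
  then show ?thesis by (simp add: holomorphic_on_def)
qed

text \<open>The imaginary axis accumulates at 0, so the identity theorem applies to each matrix
  coefficient of the difference.\<close>

lemma weak_star_entire_eq_if_eq_imaginary_axis:
  assumes F: "weak_star_entire N F" and G: "weak_star_entire N G"
    and eq: "\<And>t :: real. F (\<i> * complex_of_real t) = G (\<i> * complex_of_real t)"
  shows "F = G"
proof (intro ext blinfun_eqI)
  fix z \<xi>
  have "cinner (blinfun_apply (F z) \<xi>) \<eta> - cinner (blinfun_apply (G z) \<xi>) \<eta> = 0" for \<eta>
  \<comment> \<open>The \<open>\<xi>\<close> instantiated here is the accumulation point in the
    identity theorem, not the vector fixed above.\<close>
  proof (rule analytic_continuation[where S = UNIV and \<xi> = 0
        and U = "range (\<lambda>t. \<i> * complex_of_real t)"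
        and f = "\<lambda>z. cinner (blinfun_apply (F z) \<xi>) \<eta> - cinner (blinfun_apply (G z) \<xi>) \<eta>"])
    show "(\<lambda>z. cinner (blinfun_apply (F z) \<xi>) \<eta> - cinner (blinfun_apply (G z) \<xi>) \<eta>) holomorphic_on UNIV"
      by (intro holomorphic_intros weak_star_entire_vector_functional[OF F]
          weak_star_entire_vector_functional[OF G])
    show "0 islimpt range (\<lambda>t. \<i> * complex_of_real t)"
      unfolding islimpt_approachable
    proof (intro allI impI)
      fix e :: real assume "e > 0"
      then show "\<exists>w\<in>range (\<lambda>t. \<i> * complex_of_real t). w \<noteq> 0 \<and> dist w 0 < e"
        by (intro bexI[OF _ rangeI[of _ "e / 2"]]) (auto simp: norm_mult)
    qed
  qed (use eq in auto)
  then have "cinner (blinfun_apply (F z) \<xi> - blinfun_apply (G z) \<xi>) \<eta> = 0" for \<eta>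
    by (simp add: cinner_diff_left)
  from norm_le_if_cinner_le[of "blinfun_apply (F z) \<xi> - blinfun_apply (G z) \<xi>" 0] this
  show "blinfun_apply (F z) \<xi> = blinfun_apply (G z) \<xi>" by simp
qed

lemma modular_ext_eq:
  assumes F: "is_entire_extension N \<rho> x F"
  shows "modular_ext N \<rho> w x = F (\<i> * w)"
proof -
  have "(THE F. is_entire_extension N \<rho> x F) = F"
  proof (rule the_equality)
    show "is_entire_extension N \<rho> x F" by (rule F)
    fix G assume "is_entire_extension N \<rho> x G"
    with F show "G = F"
      unfolding is_entire_extension_def
      by (intro weak_star_entire_eq_if_eq_imaginary_axis[of N]) auto
  qed
  then show ?thesis by (simp add: modular_ext_def)
qed


section \<open>Unital completely positive maps\<close>

text \<open>The quadratic form is \<open>norm x\<close> times the squared length of the pair of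
  vectors plus twice the real part of one matrix coefficient, which Cauchy-Schwarz and
  \<open>2 * a * b \<le> a\<^sup>2 + b\<^sup>2\<close> keep nonnegative. With \<open>norm x\<close>
  on the diagonal no normalization of \<open>x\<close> is required.\<close>

lemma positive_matrix_norm_adj:
  assumes x: "x \<in> bounded_ops"
  shows "positive_matrix 2 (\<lambda>i j. if i = j then complex_of_real (norm x) *\<^sub>C id_blinfun
    else if i = 0 then x else adj x)"
  unfolding positive_matrix_def
proof
  fix \<xi> :: "nat \<Rightarrow> 'a"
  define a where "a = cinner (blinfun_apply x (\<xi> 1)) (\<xi> 0)"
  have "cinner (blinfun_apply (adj x) (\<xi> 0)) (\<xi> 1) = cnj a"
    unfolding a_def cinner_adj[OF x] by (rule cinner_commute)
  moreover have "- (norm x * ((norm (\<xi> 0))\<^sup>2 + (norm (\<xi> 1))\<^sup>2)) \<le> 2 * Re a"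
  proof -
    have "cmod a \<le> norm x * norm (\<xi> 1) * norm (\<xi> 0)"
      unfolding a_def by (rule order_trans[OF cmod_cinner_le mult_right_mono[OF norm_blinfun]]) simp
    moreover have "norm x * (2 * norm (\<xi> 1) * norm (\<xi> 0)) \<le> norm x * ((norm (\<xi> 1))\<^sup>2 + (norm (\<xi> 0))\<^sup>2)"
      by (intro mult_left_mono sum_squares_bound) simp
    ultimately show ?thesis using abs_Re_le_cmod[of a] by (simp add: algebra_simps)
  qed
  ultimately show "(\<Sum>i<2. \<Sum>j<2. cinner (blinfun_apply (if i = j
      then complex_of_real (norm x) *\<^sub>C id_blinfun else if i = 0 then x else adj x) (\<xi> j)) (\<xi> i)) \<in> \<real>\<^sub>\<ge>\<^sub>0"
    by (simp add: numeral_2_eq_2 a_def[symmetric, simplified] cinner_scaleC_left cinner_self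
        complex_nonneg_Reals_iff algebra_simps del: of_real_power)
qed

text \<open>Positivity of a 2 by 2 matrix with \<open>x\<close> off the diagonal survives
  \<open>\<Phi>\<close>, and testing the image on pairs of vectors bounds the matrix coefficients of
  \<open>\<Phi> x\<close>. Complex linearity of \<open>\<Phi> x\<close> allows one vector to be
  rotated by a phase.\<close>

lemma completely_positive_norm_le:
  fixes \<Phi> :: "'h :: chilbert_space operator \<Rightarrow> 'k :: chilbert_space operator"
  assumes N: "von_neumann_algebra N" and lin: "linear_on_algebra N \<Phi>"
    and unital: "\<Phi> id_blinfun = id_blinfun" and cp: "completely_positive_on N \<Phi>"
    and \<Phi>x: "\<Phi> x \<in> bounded_ops" and x: "x \<in> N"
  shows "norm (\<Phi> x) \<le> 2 * norm x"
proof -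
  define c where "c = norm x"
  define X where "X i j = (if i = j then complex_of_real c *\<^sub>C id_blinfun
    else if i = 0 then x else adj x)" for i j :: nat
  have "x \<in> bounded_ops" "adj x \<in> N" using N x by (auto simp: von_neumann_algebra_def)
  then have "X i j \<in> N" for i j
    using x N
    by (auto simp: X_def intro!: scaleC_in_von_neumann_algebra id_in_von_neumann_algebra)
  moreover have "positive_matrix 2 X"
    using positive_matrix_norm_adj[OF \<open>x \<in> bounded_ops\<close>] by (simp only: X_def[abs_def] c_def)
  ultimately have "positive_matrix 2 (\<lambda>i j. \<Phi> (X i j))"
    using cp unfolding completely_positive_on_def by blast
  moreover have "\<Phi> (X i j) = (if i = j then complex_of_real c *\<^sub>C id_blinfun
      else if i = 0 then \<Phi> x else \<Phi> (adj x))" for i j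
    using lin id_in_von_neumann_algebra[OF N]
    by (auto simp: X_def linear_on_algebra_def unital)
  ultimately have pos: "positive_matrix 2 (\<lambda>i j. if i = j then complex_of_real c *\<^sub>C id_blinfun
      else if i = 0 then \<Phi> x else \<Phi> (adj x))" by simp
  define A where "A \<xi> \<eta> = cinner (blinfun_apply (\<Phi> x) \<xi>) \<eta>" for \<xi> \<eta>
  define B where "B \<xi> \<eta> = cinner (blinfun_apply (\<Phi> (adj x)) \<eta>) \<xi>" for \<xi> \<eta>
  \<comment> \<open>With \<open>\<eta>\<close> in slot 0 and \<open>\<xi>\<close> in slot 1, the
    entry (0, 1) contributes \<open>A \<xi> \<eta>\<close>, the entry (1, 0) contributes
    \<open>B \<xi> \<eta>\<close>, and the diagonal contributes the squared norms.\<close>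
  have pos': "- (c * ((norm \<xi>)\<^sup>2 + (norm \<eta>)\<^sup>2)) \<le> Re (A \<xi> \<eta> + B \<xi> \<eta>) \<and> Im (A \<xi> \<eta> + B \<xi> \<eta>) = 0"
    for \<xi> \<eta>
    using pos unfolding positive_matrix_def A_def B_def
    by (elim allE[of _ "\<lambda>n. if n = 0 then \<eta> else \<xi>"])
      (simp add: numeral_2_eq_2 cinner_scaleC_left cinner_self
        complex_nonneg_Reals_iff algebra_simps del: of_real_power)
  have A_le: "cmod (A \<xi> \<eta>) \<le> c * ((norm \<xi>)\<^sup>2 + (norm \<eta>)\<^sup>2)" for \<xi> \<eta>
  proof -
    have scale: "A (u *\<^sub>C \<xi>) \<eta> + B (u *\<^sub>C \<xi>) \<eta> = u * A \<xi> \<eta> + cnj u * B \<xi> \<eta>" for u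
      using \<Phi>x by (simp add: A_def B_def bounded_ops_def cinner_scaleC_left cinner_scaleC_right)
    \<comment> \<open>\<open>Im\<close> vanishing for \<open>u = 1, \<i>\<close> says \<open>B \<xi> \<eta> = cnj (A \<xi> \<eta>)\<close>, so \<open>\<Phi>\<close> need not be shown to preserve adjoints\<close>
    have unit: "- (c * ((norm \<xi>)\<^sup>2 + (norm \<eta>)\<^sup>2)) \<le> Re (u * A \<xi> \<eta> + cnj u * B \<xi> \<eta>) \<and>
        Im (u * A \<xi> \<eta> + cnj u * B \<xi> \<eta>) = 0" if "cmod u = 1" for u
      using pos'[of "u *\<^sub>C \<xi>" \<eta>] that by (simp only: scale norm_scaleC mult_1)
    \<comment> \<open>The four phases bound twice the absolute values of the real and imaginary
      parts separately. Adding these instead of choosing the optimal phase produces the factor 2 in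
      the final bound.\<close>
    have "\<bar>Re (A \<xi> \<eta>)\<bar> + \<bar>Im (A \<xi> \<eta>)\<bar> \<le> c * ((norm \<xi>)\<^sup>2 + (norm \<eta>)\<^sup>2)"
      using unit[of 1] unit[of "-1"] unit[of "\<i>"] unit[of "-\<i>"] by (simp add: abs_if)
    then show ?thesis using cmod_le[of "A \<xi> \<eta>"] by linarith
  qed
  show ?thesis
  proof (rule norm_blinfun_bound)
    fix \<xi>
    define v where "v = blinfun_apply (\<Phi> x) \<xi>"
    show "norm (blinfun_apply (\<Phi> x) \<xi>) \<le> 2 * norm x * norm \<xi>"
    proof (cases "v = 0 \<or> \<xi> = 0")
      case False
      \<comment> \<open>rescaling \<open>v\<close> to the length of \<open>\<xi>\<close> makes both sides of \<open>A_le\<close> homogeneous\<close>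
      define t where "t = norm \<xi> / norm v"
      have "A \<xi> (t *\<^sub>R v) = complex_of_real (t * (norm v)\<^sup>2)"
        using cinner_self[of v]
        by (simp add: A_def v_def[symmetric] scaleR_scaleC cinner_scaleC_right)
      then have "cmod (A \<xi> (t *\<^sub>R v)) = norm \<xi> * norm v"
        using False by (simp add: t_def norm_mult norm_divide power2_eq_square)
      moreover have "norm (t *\<^sub>R v) = norm \<xi>" using False by (simp add: t_def)
      ultimately have "norm \<xi> * norm v \<le> norm \<xi> * (2 * c * norm \<xi>)"
        using A_le[of \<xi> "t *\<^sub>R v"] by (simp add: power2_eq_square algebra_simps)
      then show ?thesis using False by (simp add: v_def c_def)
    qed (auto simp: v_def blinfun.zero_right)
  qed simp
qed


section \<open>Markov maps\<close>

text \<open>For \<open>\<omega>\<close> in the predual of \<open>M\<close>, the functional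
  \<open>\<omega> \<circ> \<Phi>\<close> is linear and norm bounded on \<open>N\<close>, so it is
  holomorphic along \<open>F\<close>. The values on the imaginary axis come from the intertwining of
  the modular groups.\<close>

lemma markov_map_entire_extension:
  assumes N: "von_neumann_algebra N" and M: "von_neumann_algebra M"
    and \<Phi>: "markov_map N \<rho> M \<phi> \<Phi>"
    and x: "x \<in> N" and F: "is_entire_extension N \<rho> x F"
  shows "is_entire_extension M \<phi> (\<Phi> x) (\<Phi> \<circ> F)"
proof -
  have lin: "linear_on_algebra N \<Phi>" and \<Phi>M: "\<And>y. y \<in> N \<Longrightarrow> \<Phi> y \<in> M"
    using \<Phi> by (auto simp: markov_map_def)
  have F_entire: "weak_star_entire N F" and F_axis: "\<And>t. F (\<i> * complex_of_real t) = modular_aut N \<rho> t x"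
    using F by (auto simp: is_entire_extension_def)
  have \<Phi>_le: "norm (\<Phi> y) \<le> 2 * norm y" if "y \<in> N" for y
    using completely_positive_norm_le[OF N lin _ _ _ that] \<Phi> \<Phi>M[OF that] M
    by (auto simp: markov_map_def von_neumann_algebra_def)
  have "(\<lambda>z. \<omega> (\<Phi> (F z))) holomorphic_on UNIV" if \<omega>: "\<omega> \<in> predual M" for \<omega>
  proof -
    obtain B where B: "0 \<le> B" "\<And>y. y \<in> M \<Longrightarrow> cmod (\<omega> y) \<le> B * norm y"
      using predual_bounded[OF \<omega>] by blast
    have \<omega>_lin: "linear_on_algebra M \<omega>"
      by (rule predual_linear[OF M \<omega>])
    show ?thesis
    proof (rule holomorphic_bounded_functional_weak_star_entire[OF N F_entire])
      show "linear_on_algebra N (\<lambda>y. \<omega> (\<Phi> y))"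
        using lin \<omega>_lin \<Phi>M by (auto simp: linear_on_algebra_def)
      show "cmod (\<omega> (\<Phi> y)) \<le> B * 2 * norm y" if "y \<in> N" for y
        using order_trans[OF B(2)[OF \<Phi>M[OF that]] mult_left_mono[OF \<Phi>_le[OF that] B(1)]] by simp
      show "0 \<le> B * 2" using B by simp
    qed
  qed
  then show ?thesis
    using \<Phi> \<Phi>M F_entire x
    by (auto simp: is_entire_extension_def weak_star_entire_def F_axis markov_map_def)
qed

theorem lemma2p2:
  fixes N :: "('h :: chilbert_space) operator set"
    and M :: "('k :: chilbert_space) operator set"
    and \<rho> :: "'h operator \<Rightarrow> complex"
    and \<phi> :: "'k operator \<Rightarrow> complex"
    and \<Phi> :: "'h operator \<Rightarrow> 'k operator"
  assumes "von_neumann_algebra N" and "separable_predual N"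
    and "von_neumann_algebra M" and "separable_predual M"
    and "faithful_normal_state N \<rho>" and "faithful_normal_state M \<phi>"
    and "markov_map N \<rho> M \<phi> \<Phi>"
  shows "\<Phi> ` entire_elements N \<rho> \<subseteq> entire_elements M \<phi> \<and>
    (\<forall>x\<in>entire_elements N \<rho>. \<forall>z :: complex.
      \<Phi> (modular_ext N \<rho> z x) = modular_ext M \<phi> z (\<Phi> x))"
proof -
  have "\<Phi> x \<in> entire_elements M \<phi> \<and> \<Phi> (modular_ext N \<rho> z x) = modular_ext M \<phi> z (\<Phi> x)"
    if x: "x \<in> entire_elements N \<rho>" for x z
  proof -
    obtain F where xN: "x \<in> N" and F: "is_entire_extension N \<rho> x F"
      using x by (auto simp: entire_elements_def)
    have \<Phi>F: "is_entire_extension M \<phi> (\<Phi> x) (\<Phi> \<circ> F)"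
      by (rule markov_map_entire_extension[OF assms(1,3,7) xN F])
    have "\<Phi> x \<in> M" using assms(7) xN by (auto simp: markov_map_def)
    \<comment> \<open>Both sides of the equation evaluate to
      \<open>\<Phi> (F (\<i> * z))\<close>.\<close>
    with \<Phi>F show ?thesis
      by (auto simp: entire_elements_def modular_ext_eq[OF F] modular_ext_eq[OF \<Phi>F])
  qed
  then show ?thesis by blast
qed

end
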